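(* Let $G_n$ be the complete graph on $n$ vertices. Then $(\tfrac1n)_n$ is a critical sequence for $(G_n)_n$. Moreover, for all $\varepsilon>0$ and all sequences $(x_n)_n$ of positive real numbers: (1) If $\lim_{n\to\infty}(n x_n)=1+\varepsilon$, then $\lim_{n\to\infty}\frac{L(x_n,G_n)}{n}=\frac{\varepsilon}{1+\varepsilon}$ and $\lim_{n\to\infty}I(x_n,G_n)=0$. (2) If $\lim_{n\to\infty}(n x_n)=1-\varepsilon$, then $\lim_{n\to\infty}L(x_n,G_n)=\frac{1-\varepsilon}{\varepsilon}$ and $\lim_{n\to\infty}I(x_n,G_n)=1$. (3) If $x_n=\tfrac1n$, then there exists a universal constant $\alpha>0$ such that $\lim_{n\to\infty}\frac{L(x_n,G_n)}{\sqrt n}=\alpha$.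
   Context: A path $\omega=(\omega_0,\dots,\omega_m)$ in a graph $G$ is a sequence of vertices with $\omega_j$ adjacent to $\omega_{j+1}$ for all $j<m$; its length is $|\omega|=m$. It is self-avoiding if its vertices are pairwise distinct. For a vertex $o$ of $G$, $\mathsf{SAW}(o,G)$ is the set of finite self-avoiding paths in $G$ starting at $o$ (including the path of length $0$). For real $x>0$ set $Z_{o,G}(x)=\sum_{\omega\in \mathsf{SAW}(o,G)}x^{|\omega|}$ and let $\mathbb{P}_{x,o,G}$ be the probability measure on $\mathsf{SAW}(o,G)$ with $\mathbb{P}_{x,o,G}[\omega]=x^{|\omega|}/Z_{o,G}(x)$. Let $L(x,o,G)$ be the expectation of $|\omega|$ under $\mathbb{P}_{x,o,G}$, and let $I(x,o,G)=(\mathbb{P}_{x,o,G}\times\mathbb{P}_{x,o,G})[\omega\cap\omega'=\{o\}]$, the probability that two independent samples have only the vertex $o$ in common. For a (vertex-)transitive graph these do not depend on $o$, which is omitted: $Z_G(x)$, $L(x,G)$, $I(x,G)$. A sequence $(x_n)_n$ of positive reals is super-critical (for $(G_n)_n$) if $\liminf_{n\to\infty}Z_{G_n}(x_n)=\infty$, sub-critical if $\limsup_{n\to\infty}Z_{G_n}(x_n)<\infty$, and critical if for any $0<\varepsilon<1$ the sequence $(x_n(1+\varepsilon))_n$ is super-critical and $(x_n(1-\varepsilon))_n$ is sub-critical. *)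

theory Defs
  imports "HOL-Probability.Probability" "Graph_Theory.Graph_Theory"
begin

(* Undirected graphs are symmetric digraphs without loops or parallel arcs; paths are given by
   their nonempty lists of vertices, the length being the number of edges. *)

definition SAW :: "'a \<Rightarrow> ('a, 'b) pre_digraph \<Rightarrow> 'a list set" where
  "SAW v G = {w. vpath w G \<and> hd w = v}"

(* Extended nonnegative values: on an infinite graph the sum may diverge. *)
definition saw_Z_at :: "real \<Rightarrow> 'a \<Rightarrow> ('a, 'b) pre_digraph \<Rightarrow> ennreal" where
  "saw_Z_at x v G = (\<integral>\<^sup>+ w. ennreal (x ^ vwalk_length w) \<partial>count_space (SAW v G))"

definition saw_measure :: "real \<Rightarrow> 'a \<Rightarrow> ('a, 'b) pre_digraph \<Rightarrow> 'a list measure" where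
  "saw_measure x v G =
     point_measure (SAW v G) (\<lambda>w. ennreal (x ^ vwalk_length w) / saw_Z_at x v G)"

definition saw_L_at :: "real \<Rightarrow> 'a \<Rightarrow> ('a, 'b) pre_digraph \<Rightarrow> real" where
  "saw_L_at x v G = (\<integral>w. real (vwalk_length w) \<partial>saw_measure x v G)"

definition saw_I_at :: "real \<Rightarrow> 'a \<Rightarrow> ('a, 'b) pre_digraph \<Rightarrow> real" where
  "saw_I_at x v G =
     measure (saw_measure x v G \<Otimes>\<^sub>M saw_measure x v G)
       {(w, w') \<in> SAW v G \<times> SAW v G. set w \<inter> set w' = {v}}"

definition vertex_transitive :: "('a, 'b) pre_digraph \<Rightarrow> bool" where
  "vertex_transitive G \<longleftrightarrow> (\<forall>u\<in>verts G. \<forall>v\<in>verts G. \<exists>f. bij_betw f (verts G) (verts G) \<and>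
     (\<forall>a\<in>verts G. \<forall>b\<in>verts G. (a, b) \<in> arcs_ends G \<longleftrightarrow> (f a, f b) \<in> arcs_ends G) \<and> f u = v)"

(* The base point is irrelevant on vertex-transitive graphs; see the lemmas transitive_Z,
   transitive_L and transitive_I below. *)
definition base_vertex :: "('a, 'b) pre_digraph \<Rightarrow> 'a" where
  "base_vertex G = (SOME v. v \<in> verts G)"

definition saw_Z :: "real \<Rightarrow> ('a, 'b) pre_digraph \<Rightarrow> ennreal" where
  "saw_Z x G = saw_Z_at x (base_vertex G) G"

definition saw_L :: "real \<Rightarrow> ('a, 'b) pre_digraph \<Rightarrow> real" where
  "saw_L x G = saw_L_at x (base_vertex G) G"

definition saw_I :: "real \<Rightarrow> ('a, 'b) pre_digraph \<Rightarrow> real" where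
  "saw_I x G = saw_I_at x (base_vertex G) G"

(* Sequences are indexed by n \<ge> 1; the value at 0 is arbitrary. *)
definition positive_seq :: "(nat \<Rightarrow> real) \<Rightarrow> bool" where
  "positive_seq x \<longleftrightarrow> (\<forall>n\<ge>1. 0 < x n)"

definition supercritical_seq :: "(nat \<Rightarrow> ('a, 'b) pre_digraph) \<Rightarrow> (nat \<Rightarrow> real) \<Rightarrow> bool" where
  "supercritical_seq G x \<longleftrightarrow> positive_seq x \<and> liminf (\<lambda>n. saw_Z (x n) (G n)) = \<infinity>"

definition subcritical_seq :: "(nat \<Rightarrow> ('a, 'b) pre_digraph) \<Rightarrow> (nat \<Rightarrow> real) \<Rightarrow> bool" where
  "subcritical_seq G x \<longleftrightarrow> positive_seq x \<and> limsup (\<lambda>n. saw_Z (x n) (G n)) < \<infinity>"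

definition critical_seq :: "(nat \<Rightarrow> ('a, 'b) pre_digraph) \<Rightarrow> (nat \<Rightarrow> real) \<Rightarrow> bool" where
  "critical_seq G x \<longleftrightarrow> positive_seq x \<and> (\<forall>\<epsilon>. 0 < \<epsilon> \<and> \<epsilon> < 1 \<longrightarrow>
     supercritical_seq G (\<lambda>n. x n * (1 + \<epsilon>)) \<and> subcritical_seq G (\<lambda>n. x n * (1 - \<epsilon>)))"

definition complete_graph_nat :: "nat \<Rightarrow> (nat, nat \<times> nat) pre_digraph" where
  "complete_graph_nat n =
     with_proj \<lparr>pverts = {..<n}, parcs = {(u, v). u < n \<and> v < n \<and> u \<noteq> v}\<rparr>"

lemma complete_digraph_complete_graph_nat: "complete_digraph n (complete_graph_nat n)"
  unfolding complete_graph_nat_def complete_digraph_pair_def by auto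

lemma vertex_transitive_complete_graph_nat: "vertex_transitive (complete_graph_nat n)"
  unfolding vertex_transitive_def
proof (intro ballI)
  fix u v assume uv: "u \<in> verts (complete_graph_nat n)" "v \<in> verts (complete_graph_nat n)"
  let ?f = "Transposition.transpose u v"
  have "?f permutes verts (complete_graph_nat n)"
    using uv by (simp add: permutes_swap_id)
  then have b: "bij_betw ?f (verts (complete_graph_nat n)) (verts (complete_graph_nat n))"
    by (rule permutes_imp_bij)
  have "(a, b) \<in> arcs_ends (complete_graph_nat n) \<longleftrightarrow> (?f a, ?f b) \<in> arcs_ends (complete_graph_nat n)"
    if "a \<in> verts (complete_graph_nat n)" "b \<in> verts (complete_graph_nat n)" for a b
    using that bij_betwE[OF b] by (auto simp: complete_graph_nat_def inj_eq[OF inj_transpose])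
  with b show "\<exists>f. bij_betw f (verts (complete_graph_nat n)) (verts (complete_graph_nat n)) \<and>
     (\<forall>a\<in>verts (complete_graph_nat n). \<forall>b\<in>verts (complete_graph_nat n).
       (a, b) \<in> arcs_ends (complete_graph_nat n) \<longleftrightarrow> (f a, f b) \<in> arcs_ends (complete_graph_nat n)) \<and>
     f u = v"
    by (intro exI[of _ ?f]) auto
qed

lemma finite_SAW:
  assumes "finite (verts G)"
  shows "finite (SAW v G)"
proof (rule finite_subset)
  show "SAW v G \<subseteq> {w. set w \<subseteq> verts G \<and> length w \<le> card (verts G)}"
  proof
    fix w assume "w \<in> SAW v G"
    then have "distinct w" "set w \<subseteq> verts G"
      by (auto simp: SAW_def vpath_def vwalk_def)
    then show "w \<in> {w. set w \<subseteq> verts G \<and> length w \<le> card (verts G)}"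
      using card_mono[OF assms, of "set w"] distinct_card[of w] by simp
  qed
  show "finite {w. set w \<subseteq> verts G \<and> length w \<le> card (verts G)}"
    using assms by (rule finite_lists_length_le)
qed

lemma saw_Z_at_finite:
  assumes "finite (verts G)" "0 < x"
  shows "saw_Z_at x v G = ennreal (\<Sum>w\<in>SAW v G. x ^ vwalk_length w)"
  unfolding saw_Z_at_def using assms finite_SAW[OF assms(1), of v]
  by (simp add: nn_integral_count_space_finite sum_ennreal)

lemma Nil_path_in_SAW: "v \<in> verts G \<Longrightarrow> [v] \<in> SAW v G"
  by (auto simp: SAW_def vpath_def vwalk_def)

lemma prob_space_saw_measure:
  assumes "finite (verts G)" "0 < x" "v \<in> verts G"
  shows "prob_space (saw_measure x v G)"
proof
  let ?S = "\<Sum>w\<in>SAW v G. x ^ vwalk_length w"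
  have fin: "finite (SAW v G)" by (rule finite_SAW) fact
  have pos: "0 < ?S"
    by (rule sum_pos2[OF fin Nil_path_in_SAW[OF assms(3)]]) (simp_all add: assms(2) less_imp_le)
  have "emeasure (saw_measure x v G) (space (saw_measure x v G)) =
      (\<Sum>w\<in>SAW v G. ennreal (x ^ vwalk_length w) / ennreal ?S)"
    unfolding saw_measure_def saw_Z_at_finite[OF assms(1,2)]
    by (simp add: space_point_measure emeasure_point_measure_finite fin)
  also have "\<dots> = (\<Sum>w\<in>SAW v G. ennreal (x ^ vwalk_length w / ?S))"
    by (rule sum.cong[OF refl], rule divide_ennreal[OF _ pos]) (simp add: assms(2) less_imp_le)
  also have "\<dots> = ennreal (\<Sum>w\<in>SAW v G. x ^ vwalk_length w / ?S)"
    by (rule sum_ennreal, rule divide_nonneg_pos[OF _ pos]) (simp add: assms(2) less_imp_le)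
  also have "\<dots> = 1"
    unfolding sum_divide_distrib[symmetric] using pos by (metis divide_self ennreal_1 less_irrefl)
  finally show "emeasure (saw_measure x v G) (space (saw_measure x v G)) = 1" .
qed

lemma vwalk_arcs_map: "vwalk_arcs (map f w) = map (\<lambda>(a, b). (f a, f b)) (vwalk_arcs w)"
  by (induction w rule: vwalk_arcs.induct) auto

lemma set_vwalk_arcs_subset: "set (vwalk_arcs w) \<subseteq> set w \<times> set w"
  by (induction w rule: vwalk_arcs.induct) auto

lemma map_in_SAW:
  assumes "bij_betw f (verts G) (verts G)"
    and "\<And>a b. a \<in> verts G \<Longrightarrow> b \<in> verts G \<Longrightarrow>
           (a, b) \<in> arcs_ends G \<Longrightarrow> (f a, f b) \<in> arcs_ends G"
    and w: "w \<in> SAW u G"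
  shows "map f w \<in> SAW (f u) G"
proof -
  have w': "set w \<subseteq> verts G" "set (vwalk_arcs w) \<subseteq> arcs_ends G" "w \<noteq> []" "distinct w" "hd w = u"
    using w by (auto simp: SAW_def vpath_def vwalk_def)
  have "inj_on f (set w)"
    using assms(1) w'(1) by (metis bij_betw_def inj_on_subset)
  moreover have "f ` set w \<subseteq> verts G"
    using assms(1) w'(1) by (auto simp: bij_betw_def)
  moreover have "(f a, f b) \<in> arcs_ends G" if "(a, b) \<in> set (vwalk_arcs w)" for a b
    using that w'(1,2) set_vwalk_arcs_subset[of w] by (intro assms(2)) auto
  ultimately show ?thesis
    using w' by (auto simp: SAW_def vpath_def vwalk_def vwalk_arcs_map distinct_map hd_map)
qed

lemma bij_betw_SAW:
  assumes bij: "bij_betw f (verts G) (verts G)"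
    and adj: "\<And>a b. a \<in> verts G \<Longrightarrow> b \<in> verts G \<Longrightarrow>
           (a, b) \<in> arcs_ends G \<longleftrightarrow> (f a, f b) \<in> arcs_ends G"
    and u: "u \<in> verts G"
  shows "bij_betw (map f) (SAW u G) (SAW (f u) G)"
proof -
  let ?g = "the_inv_into (verts G) f"
  have inj: "inj_on f (verts G)" and im: "f ` verts G = verts G"
    using bij by (auto simp: bij_betw_def)
  have g: "bij_betw ?g (verts G) (verts G)"
    using bij by (rule bij_betw_the_inv_into)
  have fg: "f (?g a) = a" if "a \<in> verts G" for a
    using that inj im by (simp add: f_the_inv_into_f)
  have gf: "?g (f a) = a" if "a \<in> verts G" for a
    using that inj by (simp add: the_inv_into_f_f)
  have gV: "?g a \<in> verts G" if "a \<in> verts G" for a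
    using that g by (rule bij_betw_apply[rotated])
  have sub: "set w \<subseteq> verts G" if "w \<in> SAW v G" for w v
    using that by (auto simp: SAW_def vpath_def vwalk_def)
  show ?thesis
  proof (rule bij_betw_byWitness[where f' = "map ?g"])
    show "\<forall>w\<in>SAW u G. map ?g (map f w) = w"
      by (auto intro!: map_idI gf subsetD[OF sub])
    show "\<forall>w\<in>SAW (f u) G. map f (map ?g w) = w"
      by (auto intro!: map_idI fg subsetD[OF sub])
    show "map f ` SAW u G \<subseteq> SAW (f u) G"
      using map_in_SAW[OF bij adj[THEN iffD1]] by (intro image_subsetI)
    have E: "(?g a, ?g b) \<in> arcs_ends G"
      if "a \<in> verts G" "b \<in> verts G" "(a, b) \<in> arcs_ends G" for a b
      using that adj[OF gV[OF that(1)] gV[OF that(2)]] by (simp only: fg)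
    have "map ?g w \<in> SAW (?g (f u)) G" if "w \<in> SAW (f u) G" for w
      by (rule map_in_SAW[OF g E that])
    then show "map ?g ` SAW (f u) G \<subseteq> SAW u G"
      using gf[OF u] by auto
  qed
qed

lemma transitive_SAW_bij:
  assumes "vertex_transitive G" "u \<in> verts G" "v \<in> verts G"
  obtains f where "bij_betw (map f) (SAW u G) (SAW v G)" "inj_on f (verts G)" "f u = v"
proof -
  obtain f where f: "bij_betw f (verts G) (verts G)" "f u = v"
     "\<And>a b. a \<in> verts G \<Longrightarrow> b \<in> verts G \<Longrightarrow>
        (a, b) \<in> arcs_ends G \<longleftrightarrow> (f a, f b) \<in> arcs_ends G"
    using assms unfolding vertex_transitive_def by metis
  show thesis
    using bij_betw_SAW[OF f(1,3) assms(2)] f(1,2) by (intro that[of f]) (auto simp: bij_betw_def)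
qed

lemma saw_Z_at_indep:
  assumes "vertex_transitive G" "u \<in> verts G" "v \<in> verts G"
  shows "saw_Z_at x u G = saw_Z_at x v G"
proof -
  obtain f where "bij_betw (map f) (SAW u G) (SAW v G)"
    using transitive_SAW_bij[OF assms] by blast
  from nn_integral_bij_count_space[OF this, of "\<lambda>w. ennreal (x ^ vwalk_length w)"]
  show ?thesis by (simp add: saw_Z_at_def)
qed

lemma distr_saw_measure:
  assumes f: "bij_betw (map f) (SAW u G) (SAW v G)" and Z: "saw_Z_at x u G = saw_Z_at x v G"
  shows "distr (saw_measure x u G) (saw_measure x v G) (map f) = saw_measure x v G"
proof -
  define h where "h = (\<lambda>w :: 'a list. ennreal (x ^ vwalk_length w) / saw_Z_at x v G)"
  have "distr (density (count_space (SAW u G)) (h \<circ> map f)) (count_space (SAW v G)) (map f) =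
      density (distr (count_space (SAW u G)) (count_space (SAW v G)) (map f)) h"
    using f by (subst density_distr) (auto simp: bij_betw_def comp_def)
  also have "distr (count_space (SAW u G)) (count_space (SAW v G)) (map f) = count_space (SAW v G)"
    using f by (rule distr_bij_count_space)
  also have "h \<circ> map f = (\<lambda>w. ennreal (x ^ vwalk_length w) / saw_Z_at x u G)"
    by (auto simp: h_def Z)
  finally have "distr (saw_measure x u G) (count_space (SAW v G)) (map f) = saw_measure x v G"
    by (simp add: saw_measure_def point_measure_def h_def)
  moreover have "distr (saw_measure x u G) (count_space (SAW v G)) (map f) =
      distr (saw_measure x u G) (saw_measure x v G) (map f)"
    by (rule distr_cong) (auto simp: saw_measure_def sets_point_measure)
  ultimately show ?thesis by simp
qed

lemma measurable_saw_measure: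
  "g \<in> SAW u G \<rightarrow> SAW v H \<Longrightarrow> g \<in> saw_measure x u G \<rightarrow>\<^sub>M saw_measure y v H"
  by (auto simp: saw_measure_def point_measure_def)

lemma saw_L_at_indep:
  assumes "vertex_transitive G" "u \<in> verts G" "v \<in> verts G"
  shows "saw_L_at x u G = saw_L_at x v G"
proof -
  obtain f where f: "bij_betw (map f) (SAW u G) (SAW v G)"
    using transitive_SAW_bij[OF assms] by blast
  have "saw_L_at x v G =
      (\<integral>w. real (vwalk_length w) \<partial>distr (saw_measure x u G) (saw_measure x v G) (map f))"
    by (simp add: saw_L_at_def distr_saw_measure[OF f saw_Z_at_indep[OF assms]])
  also have "\<dots> = (\<integral>w. real (vwalk_length (map f w)) \<partial>saw_measure x u G)"
    using f by (intro integral_distr measurable_saw_measure)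
      (auto simp: bij_betw_def saw_measure_def point_measure_def)
  finally show ?thesis by (simp add: saw_L_at_def)
qed

lemma sets_pair_saw_measure:
  assumes "finite (verts G)"
  shows "sets (saw_measure x u G \<Otimes>\<^sub>M saw_measure x u G) = Pow (SAW u G \<times> SAW u G)"
proof -
  have "sets (saw_measure x u G \<Otimes>\<^sub>M saw_measure x u G) =
      sets (count_space (SAW u G) \<Otimes>\<^sub>M count_space (SAW u G))"
    by (intro sets_pair_measure_cong) (auto simp: saw_measure_def sets_point_measure)
  also have "count_space (SAW u G) \<Otimes>\<^sub>M count_space (SAW u G) = count_space (SAW u G \<times> SAW u G)"
    using finite_SAW[OF assms] by (intro pair_measure_count_space) auto
  finally show ?thesis by simp
qed

lemma saw_I_at_indep:
  assumes "vertex_transitive G" "finite (verts G)" "0 < x" "u \<in> verts G" "v \<in> verts G"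
  shows "saw_I_at x u G = saw_I_at x v G"
proof -
  obtain f where f: "bij_betw (map f) (SAW u G) (SAW v G)" "inj_on f (verts G)" "f u = v"
    using transitive_SAW_bij[OF assms(1,4,5)] by blast
  let ?P = "saw_measure x u G" and ?Q = "saw_measure x v G"
  let ?A = "\<lambda>u. {(w, w') \<in> SAW u G \<times> SAW u G. set w \<inter> set w' = {u}}"
  let ?F = "\<lambda>(w, w'). (map f w, map f w')"
  interpret P: prob_space ?P by (rule prob_space_saw_measure) fact+
  interpret Q: prob_space ?Q by (rule prob_space_saw_measure) fact+
  have d: "distr ?P ?Q (map f) = ?Q"
    by (rule distr_saw_measure[OF f(1) saw_Z_at_indep[OF assms(1,4,5)]])
  have m: "map f \<in> ?P \<rightarrow>\<^sub>M ?Q"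
    using f(1) by (intro measurable_saw_measure) (auto simp: bij_betw_def)
  have dp: "?Q \<Otimes>\<^sub>M ?Q = distr (?P \<Otimes>\<^sub>M ?P) (?Q \<Otimes>\<^sub>M ?Q) ?F"
    using pair_measure_distr[OF m m] d Q.sigma_finite_measure_axioms by simp
  have sp: "space (?P \<Otimes>\<^sub>M ?P) = SAW u G \<times> SAW u G"
    by (simp add: space_pair_measure saw_measure_def space_point_measure)
  have eq: "set (map f w) \<inter> set (map f w') = {v} \<longleftrightarrow> set w \<inter> set w' = {u}"
    if "w \<in> SAW u G" "w' \<in> SAW u G" for w w'
  proof -
    have s: "set w \<subseteq> verts G" "set w' \<subseteq> verts G"
      using that by (auto simp: SAW_def vpath_def vwalk_def)
    then have "f ` set w \<inter> f ` set w' = f ` (set w \<inter> set w')"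
      using f(2) by (metis inj_on_image_Int)
    moreover have "f ` (set w \<inter> set w') = f ` {u} \<longleftrightarrow> set w \<inter> set w' = {u}"
      using f(2) s assms(4) by (intro inj_on_image_eq_iff) auto
    ultimately show ?thesis using f(3) by simp
  qed
  have "map f w \<in> SAW v G" if "w \<in> SAW u G" for w
    using f(1) that by (rule bij_betw_apply)
  with eq have pre: "?F -` ?A v \<inter> space (?P \<Otimes>\<^sub>M ?P) = ?A u"
    unfolding sp by (auto simp del: set_map)
  have "measure (?Q \<Otimes>\<^sub>M ?Q) (?A v) = measure (distr (?P \<Otimes>\<^sub>M ?P) (?Q \<Otimes>\<^sub>M ?Q) ?F) (?A v)"
    by (subst dp) (rule refl)
  also have "\<dots> = measure (?P \<Otimes>\<^sub>M ?P) (?F -` ?A v \<inter> space (?P \<Otimes>\<^sub>M ?P))"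
  proof (rule measure_distr)
    show "?F \<in> ?P \<Otimes>\<^sub>M ?P \<rightarrow>\<^sub>M ?Q \<Otimes>\<^sub>M ?Q" using m by measurable
    show "?A v \<in> sets (?Q \<Otimes>\<^sub>M ?Q)" by (auto simp: sets_pair_saw_measure[OF assms(2)])
  qed
  finally show ?thesis
    by (simp only: saw_I_at_def pre)
qed

lemma base_vertex_in_verts: "v \<in> verts G \<Longrightarrow> base_vertex G \<in> verts G"
  unfolding base_vertex_def by (rule someI)

lemma transitive_Z:
  assumes "vertex_transitive G" "v \<in> verts G"
  shows "saw_Z_at x v G = saw_Z x G"
  using saw_Z_at_indep[OF assms base_vertex_in_verts[OF assms(2)]] by (simp add: saw_Z_def)

lemma transitive_L:
  assumes "vertex_transitive G" "v \<in> verts G"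
  shows "saw_L_at x v G = saw_L x G"
  using saw_L_at_indep[OF assms base_vertex_in_verts[OF assms(2)]] by (simp add: saw_L_def)

lemma transitive_I:
  assumes "vertex_transitive G" "finite (verts G)" "0 < x" "v \<in> verts G"
  shows "saw_I_at x v G = saw_I x G"
  using saw_I_at_indep[OF assms base_vertex_in_verts[OF assms(4)]] by (simp add: saw_I_def)

end

theory Submission
  imports Defs "HOL-Real_Asymp.Real_Asymp"
begin

text \<open>
Let \<open>a k\<close> be the total weight of the self-avoiding walks with \<open>k\<close> steps from a fixed vertex of the
complete graph on \<open>n\<close> vertices, and \<open>Z\<close> the sum of all \<open>a k\<close>. Extending a walk by one step gives
\<open>a (k + 1) = (n - 1 - k) x a k\<close>. Two exact identities reduce the claims to the asymptotics of \<open>Z\<close> and,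
for subcritical \<open>x\<close>, of the first moment of \<open>a\<close>.

First, summing the recursion over \<open>k\<close> yields the mean length
\<open>L = n - 1 - 1 / x + 1 / (x Z)\<close> (\<open>saw_L_eq\<close>). Second, two walks that meet only in their starting
point can be joined to one walk with a marked cut, so that the pairs of this kind have weight
\<open>\<Sum>m. (m + 1) a m\<close> and the intersection probability is \<open>I = (1 + L) / Z\<close> (\<open>saw_I_eq\<close>).

Let \<open>n x\<close> tend to \<open>c\<close>. For \<open>c < 1\<close> the weights are dominated by a geometric sequence and tend to
\<open>c^k\<close>; the length becomes geometric, \<open>Z\<close> tends to \<open>1 / (1 - c)\<close> and \<open>L\<close> to \<open>c / (1 - c)\<close>, so \<open>I\<close>
tends to \<open>1\<close> (\<open>subcritical_sum_tendsto\<close>). For \<open>c > 1\<close> the weights grow geometrically up to a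
length proportional to \<open>n\<close>, so \<open>Z / n\<close> tends to infinity
(\<open>supercritical_partition_at_top\<close>); then \<open>L / n\<close> has the limit of \<open>1 - 1 / (n x)\<close>, and
\<open>I \<le> n / Z\<close> vanishes. Criticality of \<open>1 / n\<close> follows from the two statements about \<open>Z\<close>.

At \<open>x = 1 / n\<close> the weight \<open>a k = \<Prod>i=1..k. (1 - i / n)\<close> is close to \<open>exp (- k\<^sup>2 / (2 n))\<close>, so
\<open>Z / sqrt (2 n)\<close> is nearly a Riemann sum of the Gaussian integral \<open>sqrt \<pi> / 2\<close> over the half-line;
dominated convergence makes this exact in the limit (\<open>critical_partition_tendsto\<close>). As
\<open>L = n / Z - 1\<close> here, the universal constant is \<open>sqrt (2 / \<pi>)\<close>.
\<close>

section \<open>Weights of self-avoiding walks of a given length\<close>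

text \<open>The total weight of the walks with \<open>k\<close> steps in the complete graph on \<open>n\<close> vertices: there are
\<open>(n - 1) (n - 2) \<dots> (n - k)\<close> of them. The factor with \<open>i = n\<close> makes the product vanish
for \<open>k \<ge> n \<ge> 1\<close>, so that sums over lengths can be cut at \<open>n\<close> or extended to all \<open>k\<close>, as
convenient.\<close>

definition saw_weight :: "nat \<Rightarrow> real \<Rightarrow> nat \<Rightarrow> real" where
  "saw_weight n x k = (\<Prod>i=1..k. (real n - real i) * x)"

definition saw_partition :: "nat \<Rightarrow> real \<Rightarrow> real" where
  "saw_partition n x = (\<Sum>k<n. saw_weight n x k)"

lemma saw_weight_0 [simp]: "saw_weight n x 0 = 1"
  by (simp add: saw_weight_def)

lemma saw_weight_Suc:
  "saw_weight n x (Suc k) = saw_weight n x k * ((real n - real (Suc k)) * x)"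
  by (simp add: saw_weight_def)

lemma saw_weight_eq_0: "1 \<le> n \<Longrightarrow> n \<le> k \<Longrightarrow> saw_weight n x k = 0"
  by (auto simp: saw_weight_def intro!: bexI[of _ n])

lemma saw_weight_nonneg:
  assumes "1 \<le> n" "0 \<le> x"
  shows "0 \<le> saw_weight n x k"
proof (cases "k < n")
  case True
  then show ?thesis using assms by (auto simp: saw_weight_def intro!: prod_nonneg)
qed (use assms saw_weight_eq_0[of n k x] in simp)

lemma saw_partition_ge_1:
  assumes "1 \<le> n" "0 \<le> x"
  shows "1 \<le> saw_partition n x"
proof -
  have "saw_weight n x 0 \<le> saw_partition n x"
    unfolding saw_partition_def using assms
    by (intro member_le_sum saw_weight_nonneg) auto
  then show ?thesis by simp
qed

text \<open>Sum \<open>a (k + 1) = a k * (n - 1 - k) * x\<close> over all \<open>k < n\<close>, where \<open>a k\<close> is the weight of length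
\<open>k\<close>: the left side is the sum of all \<open>a k\<close> except \<open>a 0 = 1\<close>, and on the right the factor \<open>k\<close>
produces the first moment. This is why the mean length is an explicit function of the partition
sum.\<close>

lemma weighted_length_sum:
  assumes "1 \<le> n"
  shows "x * (\<Sum>k<n. real k * saw_weight n x k) =
    ((real n - 1) * x - 1) * saw_partition n x + 1"
proof -
  have tele: "(\<Sum>k<n. saw_weight n x (Suc k) - saw_weight n x k) = - 1"
    using assms by (simp add: sum_lessThan_telescope saw_weight_eq_0)
  have "(\<Sum>k<n. saw_weight n x (Suc k) - saw_weight n x k) =
    (\<Sum>k<n. ((real n - 1) * x - 1) * saw_weight n x k - x * (real k * saw_weight n x k))"
    by (intro sum.cong refl) (simp add: saw_weight_Suc algebra_simps)
  also have "\<dots> = ((real n - 1) * x - 1) * saw_partition n x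
      - x * (\<Sum>k<n. real k * saw_weight n x k)"
    by (simp only: sum_subtractf sum_distrib_left saw_partition_def)
  finally show ?thesis using tele by linarith
qed

section \<open>From walks to weights\<close>

text \<open>A self-avoiding walk from \<open>v\<close> in a complete graph is \<open>v\<close> followed by an arbitrary duplicate-free
list of other vertices.\<close>

definition saw_tails :: "nat \<Rightarrow> nat \<Rightarrow> nat list set" where
  "saw_tails n v = {t. distinct t \<and> set t \<subseteq> {..<n} - {v}}"

lemma set_vwalk_arcs_distinct:
  "distinct w \<Longrightarrow> (a, b) \<in> set (vwalk_arcs w) \<Longrightarrow> a \<noteq> b"
  by (induction w rule: vwalk_arcs.induct) auto

lemma SAW_complete_graph:
  assumes "v < n"
  shows "SAW v (complete_graph_nat n) = (#) v ` saw_tails n v"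
proof -
  have V: "verts (complete_graph_nat n) = {..<n}"
    and E: "arcs_ends (complete_graph_nat n) = {(a, b). a < n \<and> b < n \<and> a \<noteq> b}"
    by (auto simp: complete_graph_nat_def arcs_ends_def arc_to_ends_def)
  \<comment> \<open>distinctness of the list excludes the loops, which are the only missing arcs\<close>
  have arcs: "set (vwalk_arcs w) \<subseteq> {(a, b). a < n \<and> b < n \<and> a \<noteq> b}"
    if "distinct w" "set w \<subseteq> {..<n}" for w :: "nat list"
  proof safe
    fix a b assume ab: "(a, b) \<in> set (vwalk_arcs w)"
    then have "a \<in> set w" "b \<in> set w" using set_vwalk_arcs_subset[of w] by auto
    then show "a < n" "b < n" using that(2) by auto
  next
    fix a assume "(a, a) \<in> set (vwalk_arcs w)"
    then show False using set_vwalk_arcs_distinct[OF that(1)] by blast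
  qed
  show ?thesis
  proof (intro equalityI subsetI)
    fix w assume w: "w \<in> SAW v (complete_graph_nat n)"
    then obtain t where "w = v # t"
      by (cases w) (auto simp: SAW_def vpath_def vwalk_def)
    with w show "w \<in> (#) v ` saw_tails n v"
      by (auto simp: SAW_def vpath_def vwalk_def saw_tails_def V)
  next
    fix w assume "w \<in> (#) v ` saw_tails n v"
    then obtain t where t: "w = v # t" "distinct t" "set t \<subseteq> {..<n} - {v}"
      by (auto simp: saw_tails_def)
    then have "distinct w" "set w \<subseteq> {..<n}" using assms by auto
    with arcs[OF this] t(1) show "w \<in> SAW v (complete_graph_nat n)"
      by (simp add: SAW_def vpath_def vwalk_def V E)
  qed
qed

lemma length_distinct_le_card:
  "finite A \<Longrightarrow> distinct t \<Longrightarrow> set t \<subseteq> A \<Longrightarrow> length t \<le> card A"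
  by (metis card_mono distinct_card)

lemma card_distinct_lists:
  assumes "finite A"
  shows "real (card {t. length t = k \<and> distinct t \<and> set t \<subseteq> A}) =
    (\<Prod>i<k. real (card A) - real i)"
proof (cases "k \<le> card A")
  case True
  have "real (\<Prod>{card A - k + 1 .. card A}) = (\<Prod>i<k. real (card A) - real i)"
    unfolding of_nat_prod using True
    by (intro prod.reindex_bij_witness[of _ "\<lambda>i. card A - i" "\<lambda>j. card A - j"]) auto
  then show ?thesis
    by (simp only: card_lists_distinct_length_eq[OF assms True])
next
  case False
  have empty: "{t. length t = k \<and> distinct t \<and> set t \<subseteq> A} = {}"
    using False length_distinct_le_card[OF assms] by auto
  have "(\<Prod>i<k. real (card A) - real i) = 0"
    using False by (auto intro!: bexI[of _ "card A"])
  then show ?thesis unfolding empty by simp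
qed

lemma finite_saw_tails: "finite (saw_tails n v)"
proof -
  have "saw_tails n v \<subseteq> {t. set t \<subseteq> {..<n} - {v} \<and> length t \<le> card ({..<n} - {v})}"
    using length_distinct_le_card[of "{..<n} - {v}"] by (auto simp: saw_tails_def)
  then show ?thesis
    by (rule finite_subset) (simp add: finite_lists_length_le)
qed

lemma length_saw_tails: "v < n \<Longrightarrow> t \<in> saw_tails n v \<Longrightarrow> length t < n"
  using length_distinct_le_card[of "{..<n} - {v}" t] by (auto simp: saw_tails_def)

lemma sum_saw_tails:
  assumes "v < n"
  shows "(\<Sum>t\<in>saw_tails n v. g (length t) * x ^ length t) = (\<Sum>k<n. g k * saw_weight n x k)"
proof -
  have "(\<Sum>t\<in>saw_tails n v. g (length t) * x ^ length t) =
    (\<Sum>k<n. \<Sum>t\<in>{t \<in> saw_tails n v. length t = k}. g (length t) * x ^ length t)"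
    using finite_saw_tails length_saw_tails[OF assms] by (intro sum.group[symmetric]) auto
  also have "\<dots> = (\<Sum>k<n. g k * saw_weight n x k)"
  proof (rule sum.cong[OF refl])
    fix k
    have "real (card {t \<in> saw_tails n v. length t = k}) =
      real (card {t. length t = k \<and> distinct t \<and> set t \<subseteq> {..<n} - {v}})"
      by (intro arg_cong[of _ _ "\<lambda>S. real (card S)"]) (auto simp: saw_tails_def)
    also have "\<dots> = (\<Prod>i<k. real (n - 1) - real i)"
      using assms by (subst card_distinct_lists) auto
    also have "\<dots> = (\<Prod>i=1..k. real n - real i)"
      using assms by (intro prod.reindex_bij_witness[of _ "\<lambda>i. i - 1" Suc]) auto
    finally have "real (card {t \<in> saw_tails n v. length t = k}) * x ^ k = saw_weight n x k"
      by (simp add: saw_weight_def prod.distrib)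
    then show "(\<Sum>t\<in>{t \<in> saw_tails n v. length t = k}. g (length t) * x ^ length t) =
      g k * saw_weight n x k"
      by (simp add: algebra_simps)
  qed
  finally show ?thesis .
qed

lemma sum_SAW:
  assumes "v < n"
  shows "(\<Sum>w\<in>SAW v (complete_graph_nat n). g (vwalk_length w) * x ^ vwalk_length w) =
    (\<Sum>k<n. g k * saw_weight n x k)"
  unfolding SAW_complete_graph[OF assms] sum_saw_tails[OF assms, symmetric]
  by (subst sum.reindex) (auto simp: inj_on_def)

lemma finite_verts_complete_graph [simp]: "finite (verts (complete_graph_nat n))"
  by (simp add: complete_graph_nat_def)

lemma base_vertex_complete_graph: "1 \<le> n \<Longrightarrow> base_vertex (complete_graph_nat n) < n"
  using base_vertex_in_verts[of 0 "complete_graph_nat n"] by (simp add: complete_graph_nat_def)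

lemma saw_Z_at_complete_graph:
  assumes "v < n" "0 < x"
  shows "saw_Z_at x v (complete_graph_nat n) = ennreal (saw_partition n x)"
  using sum_SAW[OF assms(1), of "\<lambda>_. 1" x] assms
  by (simp add: saw_Z_at_finite saw_partition_def)

lemma saw_Z_complete_graph:
  assumes "1 \<le> n" "0 < x"
  shows "saw_Z x (complete_graph_nat n) = ennreal (saw_partition n x)"
  unfolding saw_Z_def using assms by (intro saw_Z_at_complete_graph base_vertex_complete_graph)

lemma saw_measure_complete_graph:
  assumes "v < n" "0 < x"
  shows "saw_measure x v (complete_graph_nat n) = point_measure (SAW v (complete_graph_nat n))
    (\<lambda>w. ennreal (x ^ vwalk_length w / saw_partition n x))"
proof -
  have "1 \<le> saw_partition n x" using assms by (intro saw_partition_ge_1) auto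
  then show ?thesis
    using assms by (simp add: saw_measure_def saw_Z_at_complete_graph divide_ennreal)
qed

lemma saw_L_complete_graph:
  assumes "1 \<le> n" "0 < x"
  shows "saw_L x (complete_graph_nat n) =
    (\<Sum>k<n. real k * saw_weight n x k) / saw_partition n x"
proof -
  define v where "v = base_vertex (complete_graph_nat n)"
  have v: "v < n" unfolding v_def using assms(1) by (rule base_vertex_complete_graph)
  have Z: "1 \<le> saw_partition n x" using assms by (intro saw_partition_ge_1) auto
  have "saw_L x (complete_graph_nat n) =
    (\<Sum>w\<in>SAW v (complete_graph_nat n). x ^ vwalk_length w / saw_partition n x * real (vwalk_length w))"
    unfolding saw_L_def saw_L_at_def v_def[symmetric] saw_measure_complete_graph[OF v assms(2)]
    using Z assms by (subst lebesgue_integral_point_measure_finite) (auto simp: finite_SAW)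
  also have "\<dots> = (\<Sum>w\<in>SAW v (complete_graph_nat n). real (vwalk_length w) * x ^ vwalk_length w)
      / saw_partition n x"
    unfolding sum_divide_distrib by (intro sum.cong) (auto simp: mult_ac)
  finally show ?thesis by (simp only: sum_SAW[OF v])
qed

lemma saw_L_eq:
  assumes "1 \<le> n" "0 < x"
  shows "saw_L x (complete_graph_nat n) =
    (real n - 1) - 1 / x + 1 / (x * saw_partition n x)"
proof -
  define Z where "Z = saw_partition n x"
  define T where "T = (\<Sum>k<n. real k * saw_weight n x k)"
  have Z: "1 \<le> Z" unfolding Z_def using assms by (intro saw_partition_ge_1) auto
  have "x * T = ((real n - 1) * x - 1) * Z + 1"
    unfolding T_def Z_def by (rule weighted_length_sum[OF assms(1)])
  then have "T / Z = (((real n - 1) * x - 1) * Z + 1) / (x * Z)"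
    using assms(2) Z by (simp add: field_simps)
  also have "\<dots> = (real n - 1) - 1 / x + 1 / (x * Z)"
    using assms(2) Z by (simp add: add_divide_distrib diff_divide_distrib)
  finally show ?thesis
    unfolding saw_L_complete_graph[OF assms] T_def Z_def .
qed

text \<open>Two disjoint tails, concatenated, form a single tail, from which they are recovered once the
position of the cut is known; a tail of length \<open>m\<close> can be cut in \<open>m + 1\<close> places. Concatenation
multiplies the weights.\<close>

lemma sum_disjoint_saw_tails:
  "(\<Sum>(t, t') \<in> {(t, t'). t \<in> saw_tails n v \<and> t' \<in> saw_tails n v \<and> set t \<inter> set t' = {}}.
      x ^ length t * x ^ length t') =
   (\<Sum>s\<in>saw_tails n v. (1 + real (length s)) * x ^ length s)"
proof -
  have disjoint: False
    if "distinct s" "k \<le> length s" "a \<in> set (take k s)" "a \<in> set (drop k s)"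
    for s :: "nat list" and k a
    using that set_take_disj_set_drop_if_distinct[of s k k] by auto
  have "(\<Sum>(t, t') \<in> {(t, t'). t \<in> saw_tails n v \<and> t' \<in> saw_tails n v \<and> set t \<inter> set t' = {}}.
      x ^ length t * x ^ length t') =
    (\<Sum>(s, k)\<in>Sigma (saw_tails n v) (\<lambda>s. {..length s}). x ^ length s)"
    by (intro sum.reindex_bij_witness[of _ "\<lambda>(s, k). (take k s, drop k s)"
          "\<lambda>(t, t'). (t @ t', length t)"])
      (auto simp: saw_tails_def power_add 
        dest: in_set_takeD in_set_dropD disjoint)
  also have "\<dots> = (\<Sum>s\<in>saw_tails n v. \<Sum>k\<le>length s. x ^ length s)"
    by (intro sum.Sigma[symmetric]) (auto simp: finite_saw_tails)
  finally show ?thesis by (simp add: algebra_simps)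
qed

text \<open>Two walks from \<open>v\<close> meet only in \<open>v\<close> exactly if their tails are disjoint. By concatenation such
pairs have total weight \<open>\<Sum>m. (1 + m) a m = Z (1 + L)\<close>, where \<open>Z\<close> is the partition sum, and the
product measure divides by \<open>Z\<^sup>2\<close>.\<close>

lemma saw_I_eq:
  assumes "1 \<le> n" "0 < x"
  shows "saw_I x (complete_graph_nat n) =
    (1 + saw_L x (complete_graph_nat n)) / saw_partition n x"
proof -
  define v where "v = base_vertex (complete_graph_nat n)"
  define Z where "Z = saw_partition n x"
  define M where "M = saw_measure x v (complete_graph_nat n)"
  define S where "S = SAW v (complete_graph_nat n)"
  define A where "A = {(w, w') \<in> S \<times> S. set w \<inter> set w' = {v}}"
  define D where "D = {(t, t'). t \<in> saw_tails n v \<and> t' \<in> saw_tails n v \<and> set t \<inter> set t' = {}}"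
  have v: "v < n" unfolding v_def using assms(1) by (rule base_vertex_complete_graph)
  have Z: "1 \<le> Z" unfolding Z_def using assms by (intro saw_partition_ge_1) auto
  have finS: "finite S" by (simp add: S_def finite_SAW)
  have finA: "finite A"
    by (rule finite_subset[of _ "S \<times> S"]) (auto simp: A_def finS)
  interpret M: prob_space M
    unfolding M_def using v assms
    by (intro prob_space_saw_measure) (auto simp: complete_graph_nat_def)
  interpret MM: pair_prob_space M M ..
  have M1: "measure M {w} = x ^ vwalk_length w / Z" if "w \<in> S" for w
  proof -
    have "emeasure M {w} = ennreal (x ^ vwalk_length w / Z)"
      using that finS unfolding M_def saw_measure_complete_graph[OF v assms(2)]
      by (subst emeasure_point_measure_finite) (auto simp: S_def Z_def)
    then show ?thesis using Z assms by (simp add: measure_def)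
  qed
  have setsM: "sets M = Pow S"
    by (simp add: M_def S_def saw_measure_complete_graph[OF v assms(2)] sets_point_measure)
  have MM1: "measure (M \<Otimes>\<^sub>M M) {(w, w')} =
      x ^ vwalk_length w / Z * (x ^ vwalk_length w' / Z)" if "w \<in> S" "w' \<in> S" for w w'
  proof -
    have "measure (M \<Otimes>\<^sub>M M) ({w} \<times> {w'}) = measure M {w} * measure M {w'}"
      unfolding measure_def using that
      by (subst M.emeasure_pair_measure_Times) (auto simp: setsM enn2real_mult)
    then show ?thesis using that by (simp add: M1)
  qed
  have "saw_I x (complete_graph_nat n) = measure (M \<Otimes>\<^sub>M M) A"
    by (simp add: saw_I_def saw_I_at_def M_def S_def A_def v_def)
  also have "\<dots> = (\<Sum>p\<in>A. measure (M \<Otimes>\<^sub>M M) {p})"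
  proof (rule MM.finite_measure_eq_sum_singleton[OF finA])
    fix p assume "p \<in> A"
    then obtain w w' where p: "p = (w, w')" "w \<in> S" "w' \<in> S" by (auto simp: A_def)
    then have "{w} \<times> {w'} \<in> sets (M \<Otimes>\<^sub>M M)" by (intro pair_measureI) (auto simp: setsM)
    then show "{p} \<in> sets (M \<Otimes>\<^sub>M M)" by (simp add: p(1))
  qed
  also have "\<dots> = (\<Sum>(w, w')\<in>A. x ^ vwalk_length w / Z * (x ^ vwalk_length w' / Z))"
    by (intro sum.cong) (auto simp: A_def MM1)
  also have "\<dots> = (\<Sum>(t, t')\<in>D. x ^ length t / Z * (x ^ length t' / Z))"
    by (rule sum.reindex_bij_witness[of _ "\<lambda>(t, t'). (v # t, v # t')" "\<lambda>(w, w'). (tl w, tl w')"])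
      (auto simp: A_def D_def S_def SAW_complete_graph[OF v] saw_tails_def, blast)
  also have "\<dots> = (\<Sum>(t, t')\<in>D. x ^ length t * x ^ length t') / Z\<^sup>2"
    unfolding sum_divide_distrib by (intro sum.cong) (auto simp: power2_eq_square)
  also have "(\<Sum>(t, t')\<in>D. x ^ length t * x ^ length t') =
      (\<Sum>k<n. (1 + real k) * saw_weight n x k)"
    unfolding D_def sum_disjoint_saw_tails by (rule sum_saw_tails[OF v])
  also have "\<dots> = Z + (\<Sum>k<n. real k * saw_weight n x k)"
    by (simp add: Z_def saw_partition_def algebra_simps sum.distrib)
  also have "(\<Sum>k<n. real k * saw_weight n x k) = Z * saw_L x (complete_graph_nat n)"
    using Z by (simp add: saw_L_complete_graph[OF assms] Z_def)
  also have "Z + Z * saw_L x (complete_graph_nat n) = Z * (1 + saw_L x (complete_graph_nat n))"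
    by (simp add: distrib_left)
  finally show ?thesis
    using Z by (simp add: Z_def[symmetric] power2_eq_square)
qed

section \<open>Comparison of the weights with geometric sequences\<close>

lemma saw_weight_tendsto:
  assumes x: "(\<lambda>n. real n * x n) \<longlonglongrightarrow> c"
  shows "(\<lambda>n. saw_weight n (x n) k) \<longlonglongrightarrow> c ^ k"
proof -
  have x0: "x \<longlonglongrightarrow> 0"
  proof (rule Lim_transform_eventually)
    show "(\<lambda>n. real n * x n * (1 / real n)) \<longlonglongrightarrow> 0"
      using tendsto_mult[OF x lim_1_over_n] by simp
    show "\<forall>\<^sub>F n in sequentially. real n * x n * (1 / real n) = x n"
      using eventually_gt_at_top[of 0] by eventually_elim simp
  qed
  have "(\<lambda>n. \<Prod>i=1..k. real n * x n - real i * x n) \<longlonglongrightarrow> (\<Prod>i=1..k. c - real i * 0)"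
    by (intro tendsto_intros x x0)
  then show ?thesis by (simp add: saw_weight_def left_diff_distrib)
qed

lemma saw_weight_le_power:
  assumes "1 \<le> n" "0 \<le> x"
  shows "saw_weight n x k \<le> (real n * x) ^ k"
proof (cases "k < n")
  case True
  have "saw_weight n x k \<le> (\<Prod>i=1..k. real n * x)"
    unfolding saw_weight_def using True assms by (intro prod_mono) (auto intro!: mult_right_mono)
  then show ?thesis by simp
next
  case False
  with assms show ?thesis by (simp add: saw_weight_eq_0)
qed

lemma saw_weight_ge_power:
  assumes "k \<le> m" "0 \<le> q" "q \<le> (real n - real m) * x" "0 \<le> x"
  shows "q ^ k \<le> saw_weight n x k"
proof -
  have "(\<Prod>i=1..k. q) \<le> saw_weight n x k"
    unfolding saw_weight_def using assms
    by (intro prod_mono) (auto intro: order.trans[OF _ mult_right_mono])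
  then show ?thesis by simp
qed

lemma scaled_limit_nonneg:
  assumes "(\<lambda>n. real n * x n) \<longlonglongrightarrow> c" "positive_seq x"
  shows "0 \<le> c"
proof (rule LIMSEQ_le_const[OF assms(1)])
  show "\<exists>N. \<forall>n\<ge>N. 0 \<le> real n * x n"
    using assms(2) by (auto simp: positive_seq_def intro!: exI[of _ 1] mult_nonneg_nonneg less_imp_le)
qed

section \<open>The subcritical regime\<close>

text \<open>Since \<open>a k \<le> (n x)^k\<close>, and \<open>n x\<close> is eventually below some \<open>r < 1\<close>, the weights have a common
geometric majorant; Tannery's theorem then allows passing to the limit \<open>a k \<longlonglongrightarrow> c^k\<close> inside the
sum. The factor \<open>g\<close> will be \<open>1\<close> for the partition sum and \<open>k + 1\<close> for the first moment.\<close>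

lemma subcritical_sum_tendsto:
  fixes g :: "nat \<Rightarrow> real"
  assumes x: "(\<lambda>n. real n * x n) \<longlonglongrightarrow> c" and pos: "positive_seq x" and "c < 1"
    and g: "\<And>k. 0 \<le> g k" "\<And>r. 0 < r \<Longrightarrow> r < 1 \<Longrightarrow> summable (\<lambda>k. g k * r ^ k)"
  shows "(\<lambda>n. \<Sum>k<n. g k * saw_weight n (x n) k) \<longlonglongrightarrow> (\<Sum>k. g k * c ^ k)"
proof -
  have "0 \<le> c" using x pos by (rule scaled_limit_nonneg)
  define r where "r = (1 + c) / 2"
  have r: "0 < r" "r < 1" "c < r" using \<open>0 \<le> c\<close> \<open>c < 1\<close> by (auto simp: r_def)
  have bound: "\<forall>\<^sub>F n in sequentially. \<forall>k. norm (g k * saw_weight n (x n) k) \<le> g k * r ^ k"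
    using order_tendstoD(2)[OF x r(3)] eventually_ge_at_top[of 1]
  proof eventually_elim
    case (elim n)
    then have xn: "0 < x n" using pos by (simp add: positive_seq_def)
    have "saw_weight n (x n) k \<le> r ^ k" for k
      using saw_weight_le_power[of n "x n" k] power_mono[of "real n * x n" r k] elim xn by simp
    moreover have "0 \<le> saw_weight n (x n) k" for k
      using elim xn by (intro saw_weight_nonneg) auto
    ultimately show ?case by (auto simp: g(1) abs_mult intro: mult_left_mono)
  qed
  have "(\<lambda>n. \<Sum>k. g k * saw_weight n (x n) k) \<longlonglongrightarrow> (\<Sum>k. g k * c ^ k)"
  proof (intro tannerys_theorem[THEN conjunct2, THEN conjunct2])
    show "(\<lambda>n. g k * saw_weight n (x n) k) \<longlonglongrightarrow> g k * c ^ k" for k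
      by (intro tendsto_intros saw_weight_tendsto x)
    show "summable (\<lambda>k. g k * r ^ k)" using r by (intro g(2))
    show "\<forall>\<^sub>F (k, n) in at_top \<times>\<^sub>F sequentially. norm (g k * saw_weight n (x n) k) \<le> g k * r ^ k"
      using eventually_prodI[OF eventually_True bound]
      by (rule eventually_mono) auto
  qed simp
  moreover have "\<forall>\<^sub>F n in sequentially.
    (\<Sum>k. g k * saw_weight n (x n) k) = (\<Sum>k<n. g k * saw_weight n (x n) k)"
    using eventually_ge_at_top[of 1]
    by eventually_elim (rule suminf_finite, auto simp: saw_weight_eq_0)
  ultimately show ?thesis by (rule Lim_transform_eventually)
qed

lemma subcritical_partition_tendsto:
  assumes x: "(\<lambda>n. real n * x n) \<longlonglongrightarrow> c" and pos: "positive_seq x" and "c < 1"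
  shows "(\<lambda>n. saw_partition n (x n)) \<longlonglongrightarrow> 1 / (1 - c)"
proof -
  have "0 \<le> c" using x pos by (rule scaled_limit_nonneg)
  then show ?thesis
    using subcritical_sum_tendsto[OF assms, of "\<lambda>_. 1"] geometric_sums[of c] \<open>c < 1\<close>
    by (simp add: saw_partition_def summable_geometric sums_iff)
qed

text \<open>The limit law of the length is geometric with ratio \<open>c\<close>. Its mean is read off from the sum of
\<open>(k + 1) c^k\<close>, whose value \<open>1 / (1 - c)\<^sup>2\<close> is the square of the limit of the partition sum; for the
same reason the intersection probability tends to \<open>1\<close>.\<close>

lemma subcritical_length_tendsto:
  assumes x: "(\<lambda>n. real n * x n) \<longlonglongrightarrow> c" and pos: "positive_seq x" and "c < 1"
  shows "(\<lambda>n. saw_L (x n) (complete_graph_nat n)) \<longlonglongrightarrow> c / (1 - c)"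
proof -
  have c: "0 \<le> c" using x pos by (rule scaled_limit_nonneg)
  let ?S = "\<lambda>n. \<Sum>k<n. real (Suc k) * saw_weight n (x n) k"
  let ?Z = "\<lambda>n. saw_partition n (x n)"
  have sums: "(\<lambda>k. real (Suc k) * r ^ k) sums (1 / (1 - r)\<^sup>2)" if "0 \<le> r" "r < 1" for r :: real
    using geometric_deriv_sums[of r] that by simp
  have "?S \<longlonglongrightarrow> (\<Sum>k. real (Suc k) * c ^ k)"
    by (rule subcritical_sum_tendsto[OF assms]) (auto intro: sums_summable[OF sums] simp del: of_nat_Suc)
  also have "(\<Sum>k. real (Suc k) * c ^ k) = 1 / (1 - c)\<^sup>2"
    using sums[OF c \<open>c < 1\<close>] by (rule sums_unique[symmetric])
  finally have "(\<lambda>n. ?S n / ?Z n - 1) \<longlonglongrightarrow> 1 / (1 - c)\<^sup>2 / (1 / (1 - c)) - 1"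
    using \<open>c < 1\<close> by (intro tendsto_intros subcritical_partition_tendsto[OF assms]) auto
  also have "1 / (1 - c)\<^sup>2 / (1 / (1 - c)) = 1 / (1 - c)"
    using \<open>c < 1\<close> by (simp add: power2_eq_square)
  also have "1 / (1 - c) - 1 = c / (1 - c)"
    using \<open>c < 1\<close> by (simp add: field_simps)
  finally show ?thesis
  proof (rule Lim_transform_eventually)
    show "\<forall>\<^sub>F n in sequentially. ?S n / ?Z n - 1 = saw_L (x n) (complete_graph_nat n)"
      using eventually_ge_at_top[of 1]
    proof eventually_elim
      case (elim n)
      then have xn: "0 < x n" using pos by (simp add: positive_seq_def)
      have "1 \<le> ?Z n" using elim xn by (intro saw_partition_ge_1) auto
      moreover have "?S n = ?Z n + (\<Sum>k<n. real k * saw_weight n (x n) k)"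
        by (simp add: saw_partition_def algebra_simps sum.distrib)
      ultimately show ?case
        using saw_L_complete_graph[OF elim xn] by (simp add: add_divide_distrib)
    qed
  qed
qed

lemma subcritical_intersection_tendsto:
  assumes x: "(\<lambda>n. real n * x n) \<longlonglongrightarrow> c" and pos: "positive_seq x" and "c < 1"
  shows "(\<lambda>n. saw_I (x n) (complete_graph_nat n)) \<longlonglongrightarrow> 1"
proof -
  have "(\<lambda>n. (1 + saw_L (x n) (complete_graph_nat n)) / saw_partition n (x n))
      \<longlonglongrightarrow> (1 + c / (1 - c)) / (1 / (1 - c))"
    using \<open>c < 1\<close> by (intro tendsto_intros subcritical_length_tendsto[OF assms]
        subcritical_partition_tendsto[OF assms]) auto
  also have "(1 + c / (1 - c)) / (1 / (1 - c)) = 1"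
    using \<open>c < 1\<close> by (simp add: field_simps)
  finally show ?thesis
  proof (rule Lim_transform_eventually)
    show "\<forall>\<^sub>F n in sequentially. (1 + saw_L (x n) (complete_graph_nat n)) / saw_partition n (x n)
        = saw_I (x n) (complete_graph_nat n)"
      using eventually_ge_at_top[of 1]
      by eventually_elim (use pos in \<open>simp add: saw_I_eq positive_seq_def\<close>)
  qed
qed

section \<open>The supercritical regime\<close>

text \<open>A walk can take a small fraction \<open>\<delta> n\<close> of steps before the depletion of unvisited vertices
brings the growth factor \<open>(n - k) x\<close> below a number \<open>q > 1\<close>. Hence a single length already
contributes exponentially much to the partition sum. Growth faster than \<open>n\<close> is needed because
the intersection probability is at most \<open>n\<close> divided by the partition sum.\<close>

lemma supercritical_partition_at_top:
  assumes x: "(\<lambda>n. real n * x n) \<longlonglongrightarrow> c" and pos: "positive_seq x" and "1 < c"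
  shows "filterlim (\<lambda>n. saw_partition n (x n) / real n) at_top sequentially"
proof -
  define \<epsilon> where "\<epsilon> = c - 1"
  \<comment> \<open>\<open>n x\<close> is eventually above \<open>1 + \<epsilon> / 2\<close>; the fraction \<open>\<delta>\<close> solves \<open>(1 - \<delta>) (1 + \<epsilon> / 2) = 1 + \<epsilon> / 4\<close>\<close>
  define \<delta> where "\<delta> = \<epsilon> / (2 * (2 + \<epsilon>))"
  define q where "q = 1 + \<epsilon> / 4"
  have \<epsilon>: "0 < \<epsilon>" using \<open>1 < c\<close> by (simp add: \<epsilon>_def)
  have \<delta>: "0 < \<delta>" "\<delta> < 1" and q: "1 < q" and growth: "(1 - \<delta>) * (1 + \<epsilon> / 2) = q"
    using \<epsilon> by (auto simp: \<delta>_def q_def field_simps)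
  have "1 + \<epsilon> / 2 < c" using \<epsilon> by (simp add: \<epsilon>_def field_simps)
  have lower: "\<forall>\<^sub>F n in sequentially.
      exp (\<delta> * ln q * real n - ln q) / real n \<le> saw_partition n (x n) / real n"
    using order_tendstoD(1)[OF x \<open>1 + \<epsilon> / 2 < c\<close>] eventually_ge_at_top[of 1]
  proof eventually_elim
    case (elim n)
    then have xn: "0 < x n" using pos by (simp add: positive_seq_def)
    have big: "1 + \<epsilon> / 2 \<le> real n * x n" using elim by simp
    define m where "m = nat \<lfloor>\<delta> * real n\<rfloor>"
    have m: "real m \<le> \<delta> * real n" "\<delta> * real n - 1 \<le> real m"
      using \<delta> elim by (auto simp: m_def) 
    have "\<delta> * real n < real n" using \<delta> elim by simp
    with m have "m < n" by simp
    have "q \<le> (1 - \<delta>) * (real n * x n)"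
      using big \<delta> unfolding growth[symmetric] by (intro mult_left_mono) auto
    also have "\<dots> = (real n - \<delta> * real n) * x n" by (simp add: algebra_simps)
    also have "\<dots> \<le> (real n - real m) * x n" using m xn by (intro mult_right_mono) auto
    finally have "q ^ m \<le> saw_weight n (x n) m"
      using q xn by (intro saw_weight_ge_power[of m m]) auto
    also have "\<dots> \<le> saw_partition n (x n)"
      unfolding saw_partition_def using \<open>m < n\<close> elim xn
      by (intro member_le_sum saw_weight_nonneg) auto
    finally have "q ^ m \<le> saw_partition n (x n)" .
    moreover have "exp (\<delta> * ln q * real n - ln q) \<le> q ^ m"
    proof -
      have "(\<delta> * real n - 1) * ln q \<le> real m * ln q"
        using m q by (intro mult_right_mono) auto
      then have "exp (\<delta> * ln q * real n - ln q) \<le> exp (real m * ln q)"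
        by (simp add: algebra_simps)
      also have "\<dots> = q ^ m" using q by (simp add: exp_of_nat_mult)
      finally show ?thesis .
    qed
    ultimately show ?case using elim by (intro divide_right_mono) auto
  qed
  have "filterlim (\<lambda>n. exp (a * real n - b) / real n) at_top sequentially" if "0 < a" for a b :: real
    using that by real_asymp
  then have "filterlim (\<lambda>n. exp (\<delta> * ln q * real n - ln q) / real n) at_top sequentially"
    using \<delta> q by simp
  with lower show ?thesis by (rule filterlim_at_top_mono[rotated])
qed

text \<open>In \<open>L / n = 1 - 1 / n - 1 / (n x) + 1 / (n x Z)\<close> the last term vanishes because \<open>Z\<close> tends
to infinity.\<close>

lemma supercritical_length_tendsto:
  assumes x: "(\<lambda>n. real n * x n) \<longlonglongrightarrow> c" and pos: "positive_seq x" and "1 < c"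
  shows "(\<lambda>n. saw_L (x n) (complete_graph_nat n) / real n) \<longlonglongrightarrow> (c - 1) / c"
proof -
  let ?Z = "\<lambda>n. saw_partition n (x n)"
  have Z: "filterlim (\<lambda>n. ?Z n / real n) at_top sequentially"
    using assms by (rule supercritical_partition_at_top)
  have "(\<lambda>n. 1 - 1 / real n - inverse (real n * x n) +
      inverse (real n * x n) * (inverse (?Z n / real n) * (1 / real n)))
      \<longlonglongrightarrow> 1 - 0 - inverse c + inverse c * (0 * 0)"
    using \<open>1 < c\<close>
    by (intro tendsto_add tendsto_diff tendsto_mult tendsto_const tendsto_inverse x lim_1_over_n
        tendsto_inverse_0_at_top[OF Z]) auto
  also have "1 - 0 - inverse c + inverse c * (0 * 0) = (c - 1) / c"
    using \<open>1 < c\<close> by (simp add: field_simps)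
  finally show ?thesis
  proof (rule Lim_transform_eventually)
    show "\<forall>\<^sub>F n in sequentially. 1 - 1 / real n - inverse (real n * x n) +
        inverse (real n * x n) * (inverse (?Z n / real n) * (1 / real n)) =
        saw_L (x n) (complete_graph_nat n) / real n"
      using eventually_ge_at_top[of 1]
    proof eventually_elim
      case (elim n)
      then have xn: "0 < x n" using pos by (simp add: positive_seq_def)
      have "1 \<le> ?Z n" using elim xn by (intro saw_partition_ge_1) auto
      then show ?case
        using elim xn unfolding saw_L_eq[OF elim xn]
        by (simp add: add_divide_distrib diff_divide_distrib inverse_eq_divide mult.commute)
    qed
  qed
qed

lemma supercritical_intersection_tendsto:
  assumes x: "(\<lambda>n. real n * x n) \<longlonglongrightarrow> c" and pos: "positive_seq x" and "1 < c"
  shows "(\<lambda>n. saw_I (x n) (complete_graph_nat n)) \<longlonglongrightarrow> 0"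
proof -
  let ?Z = "\<lambda>n. saw_partition n (x n)" and ?L = "\<lambda>n. saw_L (x n) (complete_graph_nat n)"
  have "(\<lambda>n. (1 / real n + ?L n / real n) * inverse (?Z n / real n)) \<longlonglongrightarrow> (0 + (c - 1) / c) * 0"
    by (intro tendsto_add tendsto_mult lim_1_over_n supercritical_length_tendsto[OF assms]
        tendsto_inverse_0_at_top[OF supercritical_partition_at_top[OF assms]])
  then have "(\<lambda>n. (1 / real n + ?L n / real n) * inverse (?Z n / real n)) \<longlonglongrightarrow> 0" by simp
  then show ?thesis
  proof (rule Lim_transform_eventually)
    show "\<forall>\<^sub>F n in sequentially. (1 / real n + ?L n / real n) * inverse (?Z n / real n) =
        saw_I (x n) (complete_graph_nat n)"
      using eventually_ge_at_top[of 1]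
    proof eventually_elim
      case (elim n)
      then have xn: "0 < x n" using pos by (simp add: positive_seq_def)
      then show ?case
        using elim unfolding saw_I_eq[OF elim xn] by (simp add: add_divide_distrib distrib_right)
    qed
  qed
qed

section \<open>The critical regime\<close>

lemma critical_weight_eq:
  assumes "1 \<le> n"
  shows "saw_weight n (1 / real n) k = (\<Prod>i=1..k. 1 - real i / real n)"
  unfolding saw_weight_def using assms by (intro prod.cong) (auto simp: diff_divide_distrib)

lemma sum_triangular: "(\<Sum>i=Suc 0..k. real i / n) = real k * (real k + 1) / (2 * n)"
  by (induction k) (auto simp: add_divide_distrib field_simps)

lemma critical_weight_upper:
  assumes "1 \<le> n"
  shows "saw_weight n (1 / real n) k \<le> exp (- (real k * (real k + 1) / (2 * real n)))"
proof (cases "k < n")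
  case True
  have "saw_weight n (1 / real n) k \<le> (\<Prod>i=1..k. exp (- (real i / real n)))"
    unfolding critical_weight_eq[OF assms] using True
    by (intro prod_mono) (auto simp: divide_le_eq intro: order.trans[OF _ exp_ge_add_one_self])
  also have "\<dots> = exp (- (real k * (real k + 1) / (2 * real n)))"
    by (simp add: exp_sum[symmetric] sum_negf sum_triangular)
  finally show ?thesis .
next
  case False
  with assms show ?thesis by (simp add: saw_weight_eq_0)
qed

text \<open>The matching lower bound uses \<open>ln (1 - u) \<ge> - u - 2 u\<^sup>2\<close> for each factor. The quadratic terms
cost at most \<open>2 k\<^sup>3 / n\<^sup>2\<close> in the exponent, which is negligible for \<open>k\<close> of order \<open>sqrt n\<close>.\<close>

lemma critical_weight_lower:
  assumes "1 \<le> n" "2 * k \<le> n"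
  shows "exp (- (real k * (real k + 1) / (2 * real n)) - 2 * real k ^ 3 / real n ^ 2)
    \<le> saw_weight n (1 / real n) k"
proof -
  let ?u = "\<lambda>i. real i / real n"
  have "real k * (real k + 1) / (2 * real n) + 2 * real k ^ 3 / real n ^ 2 =
      (\<Sum>i=1..k. ?u i + 2 * (?u k)\<^sup>2)"
    by (simp add: sum.distrib sum_triangular power_divide power3_eq_cube power2_eq_square)
  then have "exp (- (real k * (real k + 1) / (2 * real n)) - 2 * real k ^ 3 / real n ^ 2) =
      exp (\<Sum>i=1..k. - (?u i + 2 * (?u k)\<^sup>2))"
    unfolding sum_negf by simp
  also have "\<dots> = (\<Prod>i=1..k. exp (- (?u i + 2 * (?u k)\<^sup>2)))"
    by (simp add: exp_sum)
  also have "\<dots> \<le> (\<Prod>i=1..k. 1 - ?u i)"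
  proof (intro prod_mono conjI)
    fix i assume i: "i \<in> {1..k}"
    then have u: "0 \<le> ?u i" "?u i \<le> 1 / 2" "?u i \<le> ?u k"
      using assms by (auto simp: divide_le_eq intro: divide_right_mono)
    have "(?u i)\<^sup>2 \<le> (?u k)\<^sup>2" using u by (intro power_mono) auto
    then have "- (?u i + 2 * (?u k)\<^sup>2) \<le> - ?u i - 2 * (?u i)\<^sup>2" by simp
    also have "\<dots> \<le> ln (1 - ?u i)" using u by (intro ln_one_minus_pos_lower_bound)
    finally have "exp (- (?u i + 2 * (?u k)\<^sup>2)) \<le> exp (ln (1 - ?u i))" by simp
    then show "exp (- (?u i + 2 * (?u k)\<^sup>2)) \<le> 1 - ?u i" using u by simp
  qed simp
  also have "\<dots> = saw_weight n (1 / real n) k" using critical_weight_eq[OF assms(1)] by simp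
  finally show ?thesis .
qed

text \<open>The weights as a step function of the rescaled length \<open>t = k / sqrt (2 n)\<close>, which turns the
partition sum into an integral. The factor \<open>2\<close> in the scaling makes the limit \<open>exp (- t\<^sup>2)\<close>,
whose integral over the half-line is known.\<close>

definition critical_profile :: "nat \<Rightarrow> real \<Rightarrow> real" where
  "critical_profile n t =
    indicator {0..} t * saw_weight n (1 / real n) (nat \<lfloor>t * sqrt (2 * real n)\<rfloor>)"

lemma has_integral_critical_profile:
  assumes "1 \<le> n"
  shows "has_bochner_integral lborel (critical_profile n)
    (saw_partition n (1 / real n) / sqrt (2 * real n))"
proof -
  define s where "s = sqrt (2 * real n)"
  let ?a = "saw_weight n (1 / real n)"
  have s: "0 < s" using assms by (simp add: s_def)
  have eq: "critical_profile n t = (\<Sum>k<n. ?a k * indicator {real k / s..<(real k + 1) / s} t)" for t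
  proof (cases "0 \<le> t")
    case True
    define m where "m = nat \<lfloor>t * s\<rfloor>"
    have ind: "indicator {real k / s..<(real k + 1) / s} t = (if k = m then 1 else 0 :: real)" for k
    proof -
      have "t \<in> {real k / s..<(real k + 1) / s} \<longleftrightarrow> real k \<le> t * s \<and> t * s < real k + 1"
        using s by (auto simp: field_simps)
      also have "\<dots> \<longleftrightarrow> \<lfloor>t * s\<rfloor> = int k" by (simp add: floor_eq_iff)
      also have "\<dots> \<longleftrightarrow> k = m" using True s by (auto simp: m_def)
      finally show ?thesis by (simp add: indicator_def)
    qed
    have "critical_profile n t = ?a m" using True by (simp add: critical_profile_def m_def s_def)
    also have "\<dots> = (\<Sum>k<n. if k = m then ?a k else 0)"
      using assms by (simp add: saw_weight_eq_0)
    also have "\<dots> = (\<Sum>k<n. ?a k * indicator {real k / s..<(real k + 1) / s} t)"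
      by (intro sum.cong) (auto simp: ind)
    finally show ?thesis .
  next
    case False
    moreover have "0 \<le> real k / s" for k using s by simp
    ultimately have "t < real k / s" for k by (meson not_le order.strict_trans2)
    then have "indicator {real k / s..<(real k + 1) / s} t = (0 :: real)" for k
      by (simp add: indicator_def not_le)
    then show ?thesis using False by (simp add: critical_profile_def)
  qed
  have "has_bochner_integral lborel (\<lambda>t. \<Sum>k<n. ?a k * indicator {real k / s..<(real k + 1) / s} t)
      (\<Sum>k<n. ?a k * (1 / s))"
  proof (intro has_bochner_integral_sum has_bochner_integral_mult_right)
    fix k
    have "has_bochner_integral lborel (indicator {real k / s..<(real k + 1) / s})
        (measure lborel {real k / s..<(real k + 1) / s})"
      using s by (intro has_bochner_integral_real_indicator) (simp_all add: divide_right_mono)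
    also have "measure lborel {real k / s..<(real k + 1) / s} = 1 / s"
      using s by (simp add: divide_right_mono diff_divide_distrib[symmetric])
    finally show "has_bochner_integral lborel (indicator {real k / s..<(real k + 1) / s}) (1 / s)" .
  qed
  also have "(\<Sum>k<n. ?a k * (1 / s)) = saw_partition n (1 / real n) / s"
    by (simp add: saw_partition_def sum_divide_distrib)
  also have "(\<lambda>t. \<Sum>k<n. ?a k * indicator {real k / s..<(real k + 1) / s} t) = critical_profile n"
    using eq by (intro ext) simp
  finally show ?thesis unfolding s_def .
qed

text \<open>An integrable majorant, uniform in \<open>n\<close>. With \<open>u = k / sqrt (2 n)\<close> the weight is at most
\<open>exp (- u\<^sup>2)\<close>, and \<open>u \<ge> t - 1\<close> despite the rounding. Replacing the parabola \<open>u\<^sup>2\<close> by its tangent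
\<open>2 u - 1\<close> gives exponential decay in \<open>t\<close>.\<close>

lemma critical_profile_bound:
  assumes "1 \<le> n"
  shows "norm (critical_profile n t) \<le> indicator {0..} t * exp (3 - t)"
proof (cases "0 \<le> t")
  case True
  define s where "s = sqrt (2 * real n)"
  define k where "k = nat \<lfloor>t * s\<rfloor>"
  define u where "u = real k / s"
  have s: "1 \<le> s" "s\<^sup>2 = 2 * real n" using assms by (auto simp: s_def)
  have "t * s - 1 \<le> real k" using True s by (auto simp: k_def)
  then have "(t * s - 1) / s \<le> u" unfolding u_def using s by (intro divide_right_mono) auto
  then have "t - 1 / s \<le> u" using s by (simp add: diff_divide_distrib)
  moreover have "1 / s \<le> 1" using s by simp
  ultimately have u: "t - 1 \<le> u" by simp
  have "0 \<le> (u - 1)\<^sup>2" by simp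
  then have "2 * u - 1 \<le> u\<^sup>2" by (simp add: power2_eq_square algebra_simps)
  also have "u\<^sup>2 \<le> real k * (real k + 1) / (2 * real n)"
    unfolding u_def power_divide s(2) by (intro divide_right_mono) (auto simp: power2_eq_square distrib_left)
  finally have "t - 3 \<le> real k * (real k + 1) / (2 * real n)" using u True by linarith
  then have "exp (- (real k * (real k + 1) / (2 * real n))) \<le> exp (3 - t)" by simp
  with critical_weight_upper[OF assms, of k]
  have "saw_weight n (1 / real n) k \<le> exp (3 - t)" by (rule order.trans)
  moreover have "0 \<le> saw_weight n (1 / real n) k" using assms by (intro saw_weight_nonneg) auto
  ultimately show ?thesis using True by (simp add: critical_profile_def k_def s_def)
qed (simp add: critical_profile_def)

lemma critical_profile_tendsto:
  "(\<lambda>n. critical_profile n t) \<longlonglongrightarrow> indicator {0..} t * exp (- t\<^sup>2)"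
proof (cases "0 \<le> t")
  case True
  define s where "s n = sqrt (2 * real n)" for n
  define k where "k n = nat \<lfloor>t * s n\<rfloor>" for n
  define u where "u n = real (k n) / s n" for n
  have s_lim: "filterlim s at_top sequentially" unfolding s_def by real_asymp
  have s_inv: "(\<lambda>n. 1 / s n) \<longlonglongrightarrow> 0" unfolding s_def by real_asymp
  have k: "real (k n) \<le> t * s n" "t * s n - 1 \<le> real (k n)" for n
    using True by (auto simp: k_def s_def)
  have u: "u \<longlonglongrightarrow> t"
  proof (rule tendsto_sandwich)
    show "(\<lambda>n. t - 1 / s n) \<longlonglongrightarrow> t" using tendsto_diff[OF tendsto_const s_inv, of t] by simp
    show "\<forall>\<^sub>F n in sequentially. t - 1 / s n \<le> u n"
      using filterlim_at_top_dense[THEN iffD1, OF s_lim, rule_format, of 0]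
    proof eventually_elim
      case (elim n)
      then have "(t * s n - 1) / s n \<le> u n"
        unfolding u_def using k(2)[of n] by (intro divide_right_mono) auto
      then show ?case using elim by (simp add: diff_divide_distrib)
    qed
    show "\<forall>\<^sub>F n in sequentially. u n \<le> t"
      using filterlim_at_top_dense[THEN iffD1, OF s_lim, rule_format, of 0]
      by eventually_elim (use k(1) in \<open>auto simp: u_def field_simps\<close>)
  qed simp
  have ev: "\<forall>\<^sub>F n in sequentially. 1 \<le> n \<and> 2 * k n \<le> n"
    using filterlim_at_top[THEN iffD1, OF s_lim, rule_format, of "4 * t"] eventually_ge_at_top[of 1]
  proof eventually_elim
    case (elim n)
    have "2 * real (k n) \<le> 2 * (t * s n)" using k(1)[of n] by simp
    also have "\<dots> \<le> s n * s n / 2" using mult_right_mono[OF elim(1), of "s n"] by (simp add: s_def)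
    also have "\<dots> = real n" by (simp add: s_def)
    finally show ?case using elim by simp
  qed
  \<comment> \<open>both exponents in terms of the rescaled length: the leading part tends to \<open>t\<^sup>2\<close>,
     and every correction carries a factor \<open>1 / s n\<close>\<close>
  have main: "real (k n) * (real (k n) + 1) / (2 * real n) = (u n)\<^sup>2 + u n * (1 / s n)"
    and error: "2 * real (k n) ^ 3 / real n ^ 2 = 8 * u n ^ 3 * (1 / s n)" if "1 \<le> n" for n
  proof -
    have s2: "2 * real n = (s n)\<^sup>2" and s0: "s n \<noteq> 0" using that by (auto simp: s_def)
    show "real (k n) * (real (k n) + 1) / (2 * real n) = (u n)\<^sup>2 + u n * (1 / s n)"
      unfolding s2 u_def using s0 by (simp add: field_simps power2_eq_square)
    have n: "real n = (s n)\<^sup>2 / 2" using s2 by simp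
    show "2 * real (k n) ^ 3 / real n ^ 2 = 8 * u n ^ 3 * (1 / s n)"
      unfolding n u_def using s0 by (simp add: field_simps power2_eq_square power3_eq_cube)
  qed
  have "(\<lambda>n. saw_weight n (1 / real n) (k n)) \<longlonglongrightarrow> exp (- t\<^sup>2)"
  proof (rule tendsto_sandwich)
    show "\<forall>\<^sub>F n in sequentially. exp (- ((u n)\<^sup>2 + u n * (1 / s n)) - 8 * u n ^ 3 * (1 / s n))
        \<le> saw_weight n (1 / real n) (k n)"
      using ev by eventually_elim (metis critical_weight_lower main error)
    show "\<forall>\<^sub>F n in sequentially. saw_weight n (1 / real n) (k n) \<le> exp (- ((u n)\<^sup>2 + u n * (1 / s n)))"
      using ev by eventually_elim (metis critical_weight_upper main)
    have "(\<lambda>n. exp (- ((u n)\<^sup>2 + u n * (1 / s n)) - 8 * u n ^ 3 * (1 / s n)))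
        \<longlonglongrightarrow> exp (- (t\<^sup>2 + t * 0) - 8 * t ^ 3 * 0)"
      by (intro tendsto_intros u s_inv)
    then show "(\<lambda>n. exp (- ((u n)\<^sup>2 + u n * (1 / s n)) - 8 * u n ^ 3 * (1 / s n)))
        \<longlonglongrightarrow> exp (- t\<^sup>2)" by simp
    have "(\<lambda>n. exp (- ((u n)\<^sup>2 + u n * (1 / s n)))) \<longlonglongrightarrow> exp (- (t\<^sup>2 + t * 0))"
      by (intro tendsto_intros u s_inv)
    then show "(\<lambda>n. exp (- ((u n)\<^sup>2 + u n * (1 / s n)))) \<longlonglongrightarrow> exp (- t\<^sup>2)" by simp
  qed
  then show ?thesis using True by (simp add: critical_profile_def k_def s_def)
qed (simp add: critical_profile_def)

lemma critical_partition_tendsto: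
  "(\<lambda>n. saw_partition n (1 / real n) / sqrt (2 * real n)) \<longlonglongrightarrow> sqrt pi / 2"
proof -
  have dom: "integrable lborel (\<lambda>t. indicator {0..} t * exp (3 - t) :: real)"
  proof -
    have "has_bochner_integral lborel (\<lambda>t. exp (- t) * indicator {0..} t :: real) 1"
      using nn_intergal_power_times_exp_Ici[of 0]
      by (intro has_bochner_integral_nn_integral)
        (auto simp: ennreal_mult' ennreal_indicator)
    then have "integrable lborel (\<lambda>t. exp 3 * (exp (- t) * indicator {0..} t) :: real)"
      by (intro integrable_mult_right) (auto simp: has_bochner_integral_iff)
    then show ?thesis by (simp add: exp_diff exp_minus field_simps)
  qed
  have gauss: "(\<integral>t. indicator {0..} t * exp (- t\<^sup>2) \<partial>lborel) = sqrt pi / 2"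
    using gaussian_moment_0 by (simp add: has_bochner_integral_iff)
  \<comment> \<open>shifted by one because the majorant and the integral need at least one vertex\<close>
  have prof: "integrable lborel (critical_profile (Suc n))"
    "(\<integral>t. critical_profile (Suc n) t \<partial>lborel) =
      saw_partition (Suc n) (1 / real (Suc n)) / sqrt (2 * real (Suc n))" for n
    using has_integral_critical_profile[of "Suc n"] by (auto simp only: has_bochner_integral_iff)
  have "(\<lambda>n. \<integral>t. critical_profile (Suc n) t \<partial>lborel) \<longlonglongrightarrow> (\<integral>t. indicator {0..} t * exp (- t\<^sup>2) \<partial>lborel)"
  proof (rule integral_dominated_convergence[OF _ _ dom])
    show "AE t in lborel. (\<lambda>n. critical_profile (Suc n) t) \<longlonglongrightarrow> indicator {0..} t * exp (- t\<^sup>2)"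
      by (intro AE_I2 LIMSEQ_Suc critical_profile_tendsto)
    show "AE t in lborel. norm (critical_profile (Suc n) t) \<le> indicator {0..} t * exp (3 - t)" for n
      by (intro AE_I2 critical_profile_bound) simp
    show "critical_profile (Suc n) \<in> borel_measurable lborel" for n
      using prof(1) by (rule borel_measurable_integrable)
  qed measurable
  then show ?thesis
    unfolding gauss prof(2) by (rule LIMSEQ_imp_Suc)
qed

text \<open>At \<open>x = 1 / n\<close> the two large terms of the mean length cancel and \<open>L = n / Z - 1\<close> remains, where the
partition sum \<open>Z\<close> is asymptotically \<open>sqrt (\<pi> n / 2)\<close>.\<close>

lemma critical_length_tendsto:
  "(\<lambda>n. saw_L (1 / real n) (complete_graph_nat n) / sqrt (real n)) \<longlonglongrightarrow> sqrt (2 / pi)"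
proof -
  let ?Z = "\<lambda>n. saw_partition n (1 / real n)"
  have "(\<lambda>n. 1 / sqrt 2 * inverse (?Z n / sqrt (2 * real n)) - 1 / sqrt (real n))
      \<longlonglongrightarrow> 1 / sqrt 2 * inverse (sqrt pi / 2) - 0"
  proof (intro tendsto_diff tendsto_mult tendsto_const tendsto_inverse critical_partition_tendsto)
    show "(\<lambda>n. 1 / sqrt (real n)) \<longlonglongrightarrow> 0" by real_asymp
  qed simp
  also have "1 / sqrt 2 * inverse (sqrt pi / 2) - 0 = sqrt (2 / pi)"
    using real_sqrt_mult_self[of 2] by (simp add: real_sqrt_divide field_simps)
  finally show ?thesis
  proof (rule Lim_transform_eventually)
    show "\<forall>\<^sub>F n in sequentially. 1 / sqrt 2 * inverse (?Z n / sqrt (2 * real n)) - 1 / sqrt (real n) =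
        saw_L (1 / real n) (complete_graph_nat n) / sqrt (real n)"
      using eventually_ge_at_top[of 1]
    proof eventually_elim
      case (elim n)
      then have "1 \<le> ?Z n" by (intro saw_partition_ge_1) auto
      have L: "saw_L (1 / real n) (complete_graph_nat n) = real n / ?Z n - 1"
        using elim by (simp add: saw_L_eq)
      have r: "real n = sqrt (real n) * sqrt (real n)" by simp
      have "sqrt (real n) > 0" using elim by simp
      then have "real n / ?Z n / sqrt (real n) = sqrt (real n) / ?Z n"
        using \<open>1 \<le> ?Z n\<close> by (subst (1) r) (simp add: field_simps)
      moreover have "1 / sqrt 2 * inverse (?Z n / sqrt (2 * real n)) = sqrt (real n) / ?Z n"
        by (simp add: real_sqrt_mult)
      ultimately show ?case unfolding L by (simp add: diff_divide_distrib)
    qed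
  qed
qed

section \<open>Criticality of the sequence \<open>1 / n\<close>\<close>

lemma supercritical_seq_complete_graph:
  assumes x: "(\<lambda>n. real n * x n) \<longlonglongrightarrow> c" and pos: "positive_seq x" and "1 < c"
  shows "supercritical_seq complete_graph_nat x"
proof -
  have "filterlim (\<lambda>n. saw_partition n (x n) / real n) at_top sequentially"
    using assms by (rule supercritical_partition_at_top)
  then have "filterlim (\<lambda>n. saw_partition n (x n)) at_top sequentially"
  proof (rule filterlim_at_top_mono)
    show "\<forall>\<^sub>F n in sequentially. saw_partition n (x n) / real n \<le> saw_partition n (x n)"
      using eventually_ge_at_top[of 1]
    proof eventually_elim
      case (elim n)
      then have "1 \<le> saw_partition n (x n)"
        using pos by (intro saw_partition_ge_1) (auto simp: positive_seq_def less_imp_le)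
      moreover have "saw_partition n (x n) * 1 \<le> saw_partition n (x n) * real n"
        using elim calculation by (intro mult_left_mono) auto
      ultimately show ?case using elim by (simp add: divide_le_eq)
    qed
  qed
  then have "(\<lambda>n. ennreal (saw_partition n (x n))) \<longlonglongrightarrow> \<infinity>"
    by (simp add: ennreal_tendsto_top_eq_at_top)
  moreover have "\<forall>\<^sub>F n in sequentially.
      ennreal (saw_partition n (x n)) = saw_Z (x n) (complete_graph_nat n)"
    using eventually_ge_at_top[of 1]
    by eventually_elim (use pos in \<open>simp add: saw_Z_complete_graph positive_seq_def\<close>)
  ultimately have "(\<lambda>n. saw_Z (x n) (complete_graph_nat n)) \<longlonglongrightarrow> \<infinity>"
    by (rule Lim_transform_eventually)
  then have "liminf (\<lambda>n. saw_Z (x n) (complete_graph_nat n)) = \<infinity>"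
    by (intro lim_imp_Liminf) auto
  with pos show ?thesis by (simp add: supercritical_seq_def)
qed

lemma subcritical_seq_complete_graph:
  assumes x: "(\<lambda>n. real n * x n) \<longlonglongrightarrow> c" and pos: "positive_seq x" and "c < 1"
  shows "subcritical_seq complete_graph_nat x"
proof -
  have "(\<lambda>n. ennreal (saw_partition n (x n))) \<longlonglongrightarrow> ennreal (1 / (1 - c))"
    by (intro tendsto_ennrealI subcritical_partition_tendsto[OF assms])
  moreover have "\<forall>\<^sub>F n in sequentially.
      ennreal (saw_partition n (x n)) = saw_Z (x n) (complete_graph_nat n)"
    using eventually_ge_at_top[of 1]
    by eventually_elim (use pos in \<open>simp add: saw_Z_complete_graph positive_seq_def\<close>)
  ultimately have "(\<lambda>n. saw_Z (x n) (complete_graph_nat n)) \<longlonglongrightarrow> ennreal (1 / (1 - c))"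
    by (rule Lim_transform_eventually)
  then have "limsup (\<lambda>n. saw_Z (x n) (complete_graph_nat n)) = ennreal (1 / (1 - c))"
    by (intro lim_imp_Limsup) auto
  with pos show ?thesis by (simp add: subcritical_seq_def)
qed

theorem theorem5:
  shows "critical_seq complete_graph_nat (\<lambda>n. 1 / real n) \<and>
    (\<forall>\<epsilon>>0. \<forall>x :: nat \<Rightarrow> real. positive_seq x \<longrightarrow>
      ((\<lambda>n. real n * x n) \<longlonglongrightarrow> 1 + \<epsilon> \<longrightarrow>
        (\<lambda>n. saw_L (x n) (complete_graph_nat n) / real n) \<longlonglongrightarrow> \<epsilon> / (1 + \<epsilon>) \<and>
        (\<lambda>n. saw_I (x n) (complete_graph_nat n)) \<longlonglongrightarrow> 0) \<and>
      ((\<lambda>n. real n * x n) \<longlonglongrightarrow> 1 - \<epsilon> \<longrightarrow>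
        (\<lambda>n. saw_L (x n) (complete_graph_nat n)) \<longlonglongrightarrow> (1 - \<epsilon>) / \<epsilon> \<and>
        (\<lambda>n. saw_I (x n) (complete_graph_nat n)) \<longlonglongrightarrow> 1)) \<and>
    (\<exists>\<alpha>>0. (\<lambda>n. saw_L (1 / real n) (complete_graph_nat n) / sqrt (real n)) \<longlonglongrightarrow> \<alpha>)"
proof (intro conjI allI impI)
  have scaled: "(\<lambda>n. real n * (1 / real n * c)) \<longlonglongrightarrow> c" for c
    by (rule tendsto_eventually) (use eventually_gt_at_top[of 0] in eventually_elim, simp)
  show "critical_seq complete_graph_nat (\<lambda>n. 1 / real n)"
    unfolding critical_seq_def
    by (intro conjI allI impI supercritical_seq_complete_graph[OF scaled]
        subcritical_seq_complete_graph[OF scaled]) (auto simp: positive_seq_def)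
next
  fix \<epsilon> :: real and x :: "nat \<Rightarrow> real"
  assume \<epsilon>: "0 < \<epsilon>" and pos: "positive_seq x" and x: "(\<lambda>n. real n * x n) \<longlonglongrightarrow> 1 + \<epsilon>"
  show "(\<lambda>n. saw_L (x n) (complete_graph_nat n) / real n) \<longlonglongrightarrow> \<epsilon> / (1 + \<epsilon>)"
    using supercritical_length_tendsto[OF x pos] \<epsilon> by simp
  show "(\<lambda>n. saw_I (x n) (complete_graph_nat n)) \<longlonglongrightarrow> 0"
    using supercritical_intersection_tendsto[OF x pos] \<epsilon> by simp
next
  fix \<epsilon> :: real and x :: "nat \<Rightarrow> real"
  assume \<epsilon>: "0 < \<epsilon>" and pos: "positive_seq x" and x: "(\<lambda>n. real n * x n) \<longlonglongrightarrow> 1 - \<epsilon>"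
  show "(\<lambda>n. saw_L (x n) (complete_graph_nat n)) \<longlonglongrightarrow> (1 - \<epsilon>) / \<epsilon>"
    using subcritical_length_tendsto[OF x pos] \<epsilon> by simp
  show "(\<lambda>n. saw_I (x n) (complete_graph_nat n)) \<longlonglongrightarrow> 1"
    using subcritical_intersection_tendsto[OF x pos] \<epsilon> by simp
next
  show "\<exists>\<alpha>>0. (\<lambda>n. saw_L (1 / real n) (complete_graph_nat n) / sqrt (real n)) \<longlonglongrightarrow> \<alpha>"
    using critical_length_tendsto by (intro exI[of _ "sqrt (2 / pi)"]) simp
qed

end
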